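(* Let $U$ be a real, separable Hilbert space with orthonormal basis $\{\varphi_n\}_{n\in\mathbb N}$, where $\mathbb N=\{1,2,\dots\}$, and let $L:U\to U$ be the compact linear operator defined by $L\varphi_n=2^{-n}\varphi_n$. Let \[ y=\sum_{n\ge1}2^{-\frac32n}\varphi_n\in\mathcal R(L), \] and let $u^\dagger$ be the minimum-norm solution of $Lu=y$. Then: (a) the homogeneous variational inequality with parameter $\nu=\frac12$ is fulfilled: there exists a constant $\beta\ge0$ such that $2\langle u^\dagger,u\rangle\le\beta\|Lu\|^{\frac12}\|u\|^{\frac12}$ for every $u\in U$; (b) the standard source condition with parameter $\nu=\frac12$ is not fulfilled: $u^\dagger\notin\mathcal R((L^*L)^{\frac14})$; (c) the standard source condition is fulfilled for every parameter $\nu\in(0,\frac12)$: $u^\dagger\in\mathcal R((L^*L)^{\frac\nu2})$ for every $\nu\in(0,\frac12)$. In particular, the standard source condition and the homogeneous variational inequality with the same parameter are not equivalent.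
   Context: $\mathcal R(T)$ denotes the range of an operator $T$. The minimum-norm solution $u^\dagger$ of $Lu=y$ is the unique element with $Lu^\dagger=y$ and $\|u^\dagger\|=\inf\{\|u\|:Lu=y\}$. Powers $(L^*L)^{r}$, $r>0$, are defined by the functional calculus of the self-adjoint non-negative operator $L^*L$. *)

theory Defs
  imports "HOL-Analysis.Analysis" "HOL-Computational_Algebra.Polynomial"
begin

definition orthonormal_basis_on :: "'i set \<Rightarrow> ('i \<Rightarrow> 'a::real_inner) \<Rightarrow> bool" where
  "orthonormal_basis_on I \<phi> \<longleftrightarrow>
     (\<forall>i\<in>I. \<forall>j\<in>I. \<phi> i \<bullet> \<phi> j = (if i = j then 1 else 0)) \<and> closure (span (\<phi> ` I)) = UNIV"

definition compact_operator :: "('a::real_normed_vector \<Rightarrow> 'b::real_normed_vector) \<Rightarrow> bool" where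
  "compact_operator L \<longleftrightarrow> linear L \<and> (\<forall>B. bounded B \<longrightarrow> compact (closure (L ` B)))"

definition min_norm_solution :: "('a::real_normed_vector \<Rightarrow> 'b) \<Rightarrow> 'b \<Rightarrow> 'a" where
  "min_norm_solution L y = (THE u. L u = y \<and> norm u = (INF v\<in>{v. L v = y}. norm v))"

(* Real spectrum.  For self-adjoint operators on a real Hilbert space this is the whole
   spectrum of the complexification. *)
definition spectrum :: "('a::real_normed_vector \<Rightarrow> 'a) \<Rightarrow> real set" where
  "spectrum T = {t. \<not> (\<exists>R. bounded_linear R \<and>
      (\<forall>x. R (T x - t *\<^sub>R x) = x) \<and> (\<forall>x. T (R x) - t *\<^sub>R R x = x))}"

definition poly_operator :: "real poly \<Rightarrow> ('a::real_normed_vector \<Rightarrow> 'a) \<Rightarrow> 'a \<Rightarrow> 'a" where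
  "poly_operator p T x = (\<Sum>i\<le>degree p. coeff p i *\<^sub>R (T ^^ i) x)"

(* Continuous functional calculus: f(T) is the limit in operator norm of p_n(T), for
   polynomials p_n converging to f uniformly on the spectrum of T.  Meaningful for bounded
   self-adjoint T on a Hilbert space and f continuous on the spectrum of T; then the limit
   exists and does not depend on the sequence p_n. *)
definition functional_calculus ::
  "(real \<Rightarrow> real) \<Rightarrow> ('a::real_normed_vector \<Rightarrow> 'a) \<Rightarrow> 'a \<Rightarrow> 'a" where
  "functional_calculus f T = (THE S. bounded_linear S \<and>
     (\<forall>p :: nat \<Rightarrow> real poly. uniform_limit (spectrum T) (\<lambda>n. poly (p n)) f sequentially \<longrightarrow>
        (\<lambda>n. onorm (\<lambda>x. poly_operator (p n) T x - S x)) \<longlonglongrightarrow> 0))"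

(* For T self-adjoint and non-negative, r > 0; note that 0 powr r = 0. *)
definition operator_power :: "('a::real_normed_vector \<Rightarrow> 'a) \<Rightarrow> real \<Rightarrow> 'a \<Rightarrow> 'a" where
  "operator_power T r = functional_calculus (\<lambda>t. t powr r) T"

definition standard_source_condition ::
  "('a::real_inner \<Rightarrow> 'b::real_inner) \<Rightarrow> 'a \<Rightarrow> real \<Rightarrow> bool" where
  "standard_source_condition L u \<nu> \<longleftrightarrow> u \<in> range (operator_power (adjoint L \<circ> L) (\<nu> / 2))"

definition homogeneous_variational_inequality ::
  "('a::real_inner \<Rightarrow> 'b::real_inner) \<Rightarrow> 'a \<Rightarrow> real \<Rightarrow> bool" where
  "homogeneous_variational_inequality L u \<nu> \<longleftrightarrow>
     (\<exists>\<beta>\<ge>0. \<forall>v. 2 * (u \<bullet> v) \<le> \<beta> * norm (L v) powr \<nu> * norm v powr (1 - \<nu>))"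

end

theory Submission
  imports Defs
begin

text \<open>Everything is read off the coefficients in the orthonormal basis. The solution \<open>u\<close> has the
  coefficients \<open>2 powr (- n / 2)\<close>, and \<open>u\<close> lies in the range of \<open>(L\<^sup>* L) powr (\<nu> / 2)\<close> iff
  \<open>2 powr ((\<nu> - 1/2) * n)\<close> is square summable, that is, iff \<open>\<nu> < 1/2\<close>. For the variational
  inequality, the coefficients of \<open>v\<close> satisfy both \<open>\<bar>v\<^sub>n\<bar> \<le> norm v\<close> and
  \<open>\<bar>v\<^sub>n\<bar> \<le> 2 ^ n * norm (L v)\<close>, so the terms of \<open>u \<bullet> v\<close> are dominated by an increasing and by a
  decreasing geometric sequence of the same ratio; their sum is then controlled by the geometric
  mean of \<open>norm v\<close> and \<open>norm (L v)\<close>.\<close>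

section \<open>Operators on normed spaces: boundedness, polynomials, spectrum\<close>

lemma min_norm_solution_unique:
  fixes L :: "'a::real_normed_vector \<Rightarrow> 'b"
  assumes "\<And>v. L v = y \<longleftrightarrow> v = x"
  shows "min_norm_solution L y = x"
proof -
  have "{v. L v = y} = {x}"
    using assms by auto
  then show ?thesis
    unfolding min_norm_solution_def using assms by (intro the_equality) auto
qed

text \<open>The image of the unit ball has compact closure, hence is bounded by some
  \<open>B\<close>; rescaling a nonzero vector to norm 1 turns \<open>B\<close> into an operator
  bound.\<close>

lemma compact_operator_imp_bounded_linear:
  assumes "compact_operator L"
  shows "bounded_linear L"
proof -
  interpret linear L
    using assms by (simp add: compact_operator_def)
  have "bounded (closure (L ` cball 0 1))"
    using assms bounded_cball compact_imp_bounded unfolding compact_operator_def by blast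
  then have "bounded (L ` cball 0 1)"
    using bounded_subset closure_subset by blast
  then obtain B where B: "\<And>x. norm x \<le> 1 \<Longrightarrow> norm (L x) \<le> B"
    unfolding bounded_iff by (metis dist_0_norm image_eqI mem_cball)
  have "norm (L x) \<le> norm x * B" for x
  proof (cases "x = 0")
    case False
    have "norm (L x) / norm x = norm (L ((1 / norm x) *\<^sub>R x))"
      using False by (simp add: scaleR)
    also have "\<dots> \<le> B"
      using False by (intro B) simp
    finally show ?thesis
      using False by (simp add: field_simps)
  qed (simp add: zero)
  then show ?thesis
    by (intro bounded_linear_intro[where K = B]) (auto simp: add scaleR)
qed

lemma bounded_linear_funpow:
  fixes T :: "'a::real_normed_vector \<Rightarrow> 'a"
  assumes "bounded_linear T"
  shows "bounded_linear (T ^^ k)"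
proof (induction k)
  case 0
  then show ?case by (simp add: id_def bounded_linear_ident)
next
  case (Suc k)
  then show ?case
    using bounded_linear_compose[OF assms Suc] by (simp add: o_def)
qed

lemma bounded_linear_poly_operator:
  assumes "bounded_linear T"
  shows "bounded_linear (poly_operator p T)"
  unfolding poly_operator_def
  by (intro bounded_linear_sum bounded_linear_const_scaleR bounded_linear_funpow assms)

lemma poly_operator_eigenvector:
  assumes "linear T" "T x = c *\<^sub>R x"
  shows "poly_operator p T x = poly p c *\<^sub>R x"
proof -
  interpret linear T by fact
  have "(T ^^ i) x = c ^ i *\<^sub>R x" for i
    by (induction i) (use assms(2) in \<open>auto simp: scale mult.commute\<close>)
  then show ?thesis
    by (simp add: poly_operator_def poly_altdef scaleR_sum_left)
qed

text \<open>A linear left inverse of \<open>T - c\<close> would have to send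
  \<open>T x - c x = 0\<close> back to \<open>x\<close>, which is nonzero.\<close>

lemma eigenvalue_in_spectrum:
  assumes "T x = c *\<^sub>R x" "x \<noteq> 0"
  shows "c \<in> spectrum T"
proof -
  {
    fix R assume "bounded_linear R" and R: "\<And>v. R (T v - c *\<^sub>R v) = v"
    then have "x = 0"
      using R[of x] assms(1) by (simp add: linear_0 bounded_linear.linear)
  }
  then show ?thesis
    using assms(2) unfolding spectrum_def by blast
qed

text \<open>Limits in operator norm are pointwise limits, which later makes the operator described
  by \<open>functional_calculus\<close> unique.\<close>

lemma tendsto_if_onorm_tendsto_0:
  assumes "\<And>n. bounded_linear (P n)" "bounded_linear S"
    and "(\<lambda>n. onorm (\<lambda>x. P n x - S x)) \<longlonglongrightarrow> 0"
  shows "(\<lambda>n. P n x) \<longlonglongrightarrow> S x"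
proof -
  have "(\<lambda>n. P n x - S x) \<longlonglongrightarrow> 0"
  proof (rule Lim_null_comparison)
    show "\<forall>\<^sub>F n in sequentially. norm (P n x - S x) \<le> onorm (\<lambda>x. P n x - S x) * norm x"
      by (intro always_eventually allI onorm bounded_linear_sub assms)
    show "(\<lambda>n. onorm (\<lambda>x. P n x - S x) * norm x) \<longlonglongrightarrow> 0"
      using tendsto_mult_left_zero[OF assms(3)] by simp
  qed
  then show ?thesis
    by (simp add: LIM_zero_iff)
qed

section \<open>Uniform polynomial approximation and a sum estimate\<close>

text \<open>Brings Stone-Weierstrass into the form that \<open>functional_calculus\<close>
  quantifies over: a sequence of type \<open>real poly\<close>, here with error below
  \<open>1 / Suc n\<close>.\<close>

lemma Weierstrass_uniform_limit:
  fixes f :: "real \<Rightarrow> real"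
  assumes "compact A" "continuous_on A f"
  obtains p :: "nat \<Rightarrow> real poly" where "uniform_limit A (\<lambda>n. poly (p n)) f sequentially"
proof -
  have "\<exists>p. \<forall>x\<in>A. \<bar>f x - poly p x\<bar> < 1 / real (Suc n)" for n
  proof -
    obtain g where g: "real_polynomial_function g" "\<And>x. x \<in> A \<Longrightarrow> \<bar>f x - g x\<bar> < 1 / real (Suc n)"
      using Stone_Weierstrass_real_polynomial_function[OF assms, of "1 / real (Suc n)"] by auto
    then obtain a m where "g = (\<lambda>x. \<Sum>i\<le>m. a i * x ^ i)"
      unfolding real_polynomial_function_iff_sum by auto
    then have "g = poly (\<Sum>i\<le>m. monom (a i) i)"
      by (auto simp: poly_sum poly_monom)
    then show ?thesis
      using g(2) by auto
  qed
  then obtain p where p: "\<And>n x. x \<in> A \<Longrightarrow> \<bar>f x - poly (p n) x\<bar> < 1 / real (Suc n)"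
    by metis
  have "uniform_limit A (\<lambda>n. poly (p n)) f sequentially"
  proof (rule uniform_limitI)
    fix \<epsilon> :: real assume "\<epsilon> > 0"
    then have "\<forall>\<^sub>F n in sequentially. 1 / real (Suc n) < \<epsilon>"
      using order_tendstoD(2)[OF LIMSEQ_inverse_real_of_nat, of \<epsilon>] by (simp add: inverse_eq_divide)
    then show "\<forall>\<^sub>F n in sequentially. \<forall>x\<in>A. dist (poly (p n) x) (f x) < \<epsilon>"
    proof eventually_elim
      case (elim n)
      then show ?case
        using p[of _ n] by (force simp: dist_real_def abs_minus_commute)
    qed
  qed
  then show thesis by (rule that)
qed

text \<open>The sum is split at the index \<open>N\<close> where the two bounds cross, that is
  \<open>q ^ N \<approx> sqrt (b / a)\<close>.\<close>

lemma sum_le_if_geometric_bounds: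
  fixes t :: "nat \<Rightarrow> real"
  assumes "a > 0" "b > 0" "q > 1"
    and nonneg: "\<And>n. 0 \<le> t n" and le_a: "\<And>n. t n \<le> q ^ n * a" and le_b: "\<And>n. t n \<le> b / q ^ n"
  shows "sum t {..<M} \<le> 2 * q / (q - 1) * (sqrt a * sqrt b)"
proof -
  define \<alpha> \<beta> where "\<alpha> = sqrt a" and "\<beta> = sqrt b"
  have ab: "\<alpha> > 0" "\<beta> > 0" "a = \<alpha> * \<alpha>" "b = \<beta> * \<beta>"
    using assms by (auto simp: \<alpha>_def \<beta>_def)
  obtain k where "\<beta> / \<alpha> < q ^ k"
    using real_arch_pow[OF \<open>q > 1\<close>] by blast
  then have k: "\<beta> \<le> \<alpha> * q ^ k"
    using ab by (simp add: field_simps)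
  define N where "N = (LEAST n. \<beta> \<le> \<alpha> * q ^ n)"
  have N: "\<beta> \<le> \<alpha> * q ^ N"
    unfolding N_def by (rule LeastI[of "\<lambda>n. \<beta> \<le> \<alpha> * q ^ n", OF k])
  have "(\<Sum>n<N. t n) \<le> q / (q - 1) * (\<alpha> * \<beta>)"
  proof (cases N)
    case 0
    then show ?thesis using ab \<open>q > 1\<close> by simp
  next
    case (Suc m)
    then have "\<not> \<beta> \<le> \<alpha> * q ^ m"
      unfolding N_def using not_less_Least[of m "\<lambda>n. \<beta> \<le> \<alpha> * q ^ n"] by simp
    \<comment> \<open>By minimality of \<open>N\<close>, the index \<open>m = N - 1\<close> has not
      reached the crossing. Hence \<open>a * q ^ N = q * (\<alpha> * (\<alpha> * q ^ m))\<close> is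
      at most \<open>q * (\<alpha> * \<beta>)\<close>.\<close>
    then have *: "\<alpha> * (\<alpha> * q ^ m) \<le> \<alpha> * \<beta>"
      using ab by (intro mult_left_mono) auto
    have "(\<Sum>n<N. t n) \<le> (\<Sum>n<N. q ^ n * a)"
      by (intro sum_mono le_a)
    also have "\<dots> = (q ^ N - 1) / (q - 1) * a"
      using \<open>q > 1\<close> by (simp add: geometric_sum flip: sum_distrib_right)
    also have "\<dots> \<le> q ^ N / (q - 1) * a"
      using assms by (intro mult_right_mono divide_right_mono) auto
    also have "\<dots> = q / (q - 1) * (\<alpha> * (\<alpha> * q ^ m))"
      using Suc ab by simp
    also have "\<dots> \<le> q / (q - 1) * (\<alpha> * \<beta>)"
      using \<open>q > 1\<close> by (intro mult_left_mono[OF *]) auto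
    finally show ?thesis .
  qed
  moreover have "(\<Sum>i<M. t (N + i)) \<le> q / (q - 1) * (\<alpha> * \<beta>)"
  proof -
    \<comment> \<open>From \<open>N\<close> on the decreasing bound takes over; its first value
      \<open>b / q ^ N\<close> is at most \<open>\<alpha> * \<beta>\<close> by the choice of
      \<open>N\<close>.\<close>
    have "(\<Sum>i<M. t (N + i)) \<le> (\<Sum>i<M. b / q ^ N * (1 / q) ^ i)"
      using le_b[of "N + _"] by (intro sum_mono) (simp add: power_add power_divide)
    also have "\<dots> = b / q ^ N * (\<Sum>i<M. (1 / q) ^ i)"
      by (simp add: sum_distrib_left)
    also have "\<dots> \<le> (\<alpha> * \<beta>) * (1 / (1 - 1 / q))"
    proof (intro mult_mono)
      have "\<beta> * \<beta> \<le> (\<alpha> * q ^ N) * \<beta>"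
        using N ab by (intro mult_right_mono) auto
      then show "b / q ^ N \<le> \<alpha> * \<beta>"
        using ab \<open>q > 1\<close> by (simp add: field_simps)
      show "(\<Sum>i<M. (1 / q) ^ i) \<le> 1 / (1 - 1 / q)"
        using \<open>q > 1\<close> by (intro less_imp_le geometric_sum_less) auto
    qed (use ab \<open>q > 1\<close> in \<open>auto intro!: sum_nonneg\<close>)
    also have "\<dots> = q / (q - 1) * (\<alpha> * \<beta>)"
      using \<open>q > 1\<close> by (simp add: field_simps)
    finally show ?thesis .
  qed
  \<comment> \<open>Padding the sum to \<open>N + M\<close> terms, possible since \<open>t\<close>
    is non-negative, avoids a case distinction between \<open>M < N\<close> and
    \<open>N \<le> M\<close>.\<close>
  moreover have "sum t {..<M} \<le> sum t {..<N + M}"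
    by (intro sum_mono2) (auto simp: nonneg)
  moreover have "sum t {..<N + M} = (\<Sum>n<N. t n) + (\<Sum>i<M. t (N + i))"
    by (induction M) auto
  ultimately have "sum t {..<M} \<le> q / (q - 1) * (\<alpha> * \<beta>) + q / (q - 1) * (\<alpha> * \<beta>)"
    by linarith
  also have "\<dots> = 2 * q / (q - 1) * (\<alpha> * \<beta>)"
    by (simp add: field_simps)
  finally show ?thesis
    by (simp add: \<alpha>_def \<beta>_def)
qed

section \<open>Expansion in an orthonormal basis\<close>

text \<open>Indices start at 0 to fit \<open>sums\<close> and \<open>summable\<close>. The basis of
  the theorem enters as \<open>e n = \<phi> (Suc n)\<close>, which explains the exponents
  \<open>Suc n\<close> below.\<close>

locale hilbert_basis =
  fixes e :: "nat \<Rightarrow> 'a::{real_inner, banach}"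
  assumes orthonormal: "e i \<bullet> e j = (if i = j then 1 else 0)"
    and dense: "closure (span (range e)) = UNIV"
begin

lemma e_nonzero: "e n \<noteq> 0"
  using orthonormal[of n n] by auto

lemma inner_sum_e: "(\<Sum>i\<in>A. c i *\<^sub>R e i) \<bullet> e n = (if n \<in> A then c n else 0)" if "finite A"
proof -
  have "(\<Sum>i\<in>A. c i *\<^sub>R e i) \<bullet> e n = (\<Sum>i\<in>A. if i = n then c i else 0)"
    unfolding inner_sum_left by (rule sum.cong) (auto simp: orthonormal)
  then show ?thesis using that by simp
qed

lemma norm_sum_e: "(norm (\<Sum>i\<in>A. c i *\<^sub>R e i))\<^sup>2 = (\<Sum>i\<in>A. (c i)\<^sup>2)" if "finite A"
proof -
  have "(norm (\<Sum>i\<in>A. c i *\<^sub>R e i))\<^sup>2 = (\<Sum>j\<in>A. c j * ((\<Sum>i\<in>A. c i *\<^sub>R e i) \<bullet> e j))"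
    by (simp add: power2_norm_eq_inner inner_sum_right)
  also have "\<dots> = (\<Sum>i\<in>A. (c i)\<^sup>2)"
    using that by (intro sum.cong) (auto simp: inner_sum_e power2_eq_square)
  finally show ?thesis .
qed

text \<open>The vectors orthogonal to \<open>x - y\<close> form a closed subspace containing the
  basis, hence the whole space, and in particular \<open>x - y\<close> itself.\<close>

lemma eq_if_coeffs_eq:
  assumes "\<And>n. x \<bullet> e n = y \<bullet> e n"
  shows "x = y"
proof -
  let ?V = "{v. (x - y) \<bullet> v = 0}"
  have "span (range e) \<subseteq> ?V"
  proof (rule span_minimal)
    show "range e \<subseteq> ?V" using assms by (auto simp: inner_diff_left)
    show "subspace ?V" by (rule subspace_hyperplane)
  qed
  then have "closure (span (range e)) \<subseteq> ?V"
    by (intro closure_minimal closed_hyperplane)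
  then have "(x - y) \<bullet> (x - y) = 0" unfolding dense by blast
  then show ?thesis by simp
qed

lemma eq_iff_coeffs_eq: "x = y \<longleftrightarrow> (\<forall>n. x \<bullet> e n = y \<bullet> e n)"
  by (auto intro: eq_if_coeffs_eq)

text \<open>By orthonormality the squared norm of a block of the series is the same block of the sum
  of squares, so the partial sums are Cauchy and completeness applies. Continuity of the inner
  product yields the coefficients.\<close>

theorem Riesz_Fischer:
  fixes c :: "nat \<Rightarrow> real"
  assumes "summable (\<lambda>n. (c n)\<^sup>2)"
  obtains x where "(\<lambda>n. c n *\<^sub>R e n) sums x" "\<And>n. x \<bullet> e n = c n"
proof -
  have "summable (\<lambda>n. c n *\<^sub>R e n)"
    unfolding summable_Cauchy
  proof (intro allI impI)
    fix \<epsilon> :: real assume "\<epsilon> > 0"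
    then obtain N where N: "\<And>m n. m \<ge> N \<Longrightarrow> \<bar>\<Sum>i=m..<n. (c i)\<^sup>2\<bar> < \<epsilon>\<^sup>2"
      using assms unfolding summable_Cauchy real_norm_def by (meson zero_less_power)
    have "norm (\<Sum>i=m..<n. c i *\<^sub>R e i) < \<epsilon>" if "m \<ge> N" for m n
      using N[OF that, of n] \<open>\<epsilon> > 0\<close>
      by (intro power_less_imp_less_base[of _ 2 \<epsilon>]) (auto simp: norm_sum_e)
    then show "\<exists>N. \<forall>m\<ge>N. \<forall>n. norm (\<Sum>i=m..<n. c i *\<^sub>R e i) < \<epsilon>"
      by blast
  qed
  then obtain x where x: "(\<lambda>n. c n *\<^sub>R e n) sums x"
    by (auto simp: summable_def)
  have "x \<bullet> e n = c n" for n
  proof -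
    have "(\<lambda>i. (c i *\<^sub>R e i) \<bullet> e n) sums (x \<bullet> e n)"
      by (rule bounded_linear.sums[OF bounded_linear_inner_left x])
    also have "(\<lambda>i. (c i *\<^sub>R e i) \<bullet> e n) = (\<lambda>i. if i = n then c i else 0)"
      by (auto simp: orthonormal)
    finally show ?thesis
      using sums_single[of n c] sums_unique2 by blast
  qed
  with x show thesis by (rule that)
qed

text \<open>Bessel's inequality: the squared distance from \<open>x\<close> to its partial expansion
  is non-negative.\<close>

lemma summable_coeffs: "summable (\<lambda>n. (x \<bullet> e n)\<^sup>2)"
proof (rule bounded_imp_summable)
  fix n
  let ?P = "\<Sum>i\<le>n. (x \<bullet> e i) *\<^sub>R e i"
  have "x \<bullet> ?P = (\<Sum>i\<le>n. (x \<bullet> e i)\<^sup>2)"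
    by (simp add: inner_sum_right power2_eq_square)
  then have "(norm (x - ?P))\<^sup>2 = (norm x)\<^sup>2 - (\<Sum>i\<le>n. (x \<bullet> e i)\<^sup>2)"
    using norm_sum_e[of "{..n}" "\<lambda>i. x \<bullet> e i"]
    by (simp add: power2_norm_eq_inner inner_diff_left inner_diff_right inner_commute)
  then show "(\<Sum>i\<le>n. (x \<bullet> e i)\<^sup>2) \<le> (norm x)\<^sup>2"
    by (smt (verit) zero_le_power2)
qed auto

text \<open>The series converges to a vector with the coefficients of \<open>x\<close>, and
  coefficients determine the vector.\<close>

lemma expansion: "(\<lambda>n. (x \<bullet> e n) *\<^sub>R e n) sums x"
proof (rule Riesz_Fischer[OF summable_coeffs])
  fix y assume "(\<lambda>n. (x \<bullet> e n) *\<^sub>R e n) sums y" "\<And>n. y \<bullet> e n = x \<bullet> e n"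
  then show ?thesis
    by (metis eq_if_coeffs_eq)
qed

lemma inner_expansion: "(\<lambda>n. (x \<bullet> e n) * (y \<bullet> e n)) sums (x \<bullet> y)"
  using bounded_linear.sums[OF bounded_linear_inner_left expansion, of x y]
  by (simp add: inner_commute)

lemma Parseval: "(\<lambda>n. (x \<bullet> e n)\<^sup>2) sums (norm x)\<^sup>2"
  using inner_expansion[of x x] unfolding power2_norm_eq_inner by (simp only: power2_eq_square)

lemma norm_le_if_coeffs_le:
  assumes "\<And>n. \<bar>x \<bullet> e n\<bar> \<le> C * \<bar>y \<bullet> e n\<bar>" "0 \<le> C"
  shows "norm x \<le> C * norm y"
proof (rule power2_le_imp_le)
  have "(\<lambda>n. C\<^sup>2 * (y \<bullet> e n)\<^sup>2) sums (C\<^sup>2 * (norm y)\<^sup>2)"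
    by (intro sums_mult Parseval)
  moreover have "(x \<bullet> e n)\<^sup>2 \<le> C\<^sup>2 * (y \<bullet> e n)\<^sup>2" for n
    using power_mono[OF assms(1), of n 2] by (simp add: power_mult_distrib)
  ultimately have "(norm x)\<^sup>2 \<le> C\<^sup>2 * (norm y)\<^sup>2"
    by (intro sums_le[OF _ Parseval])
  then show "(norm x)\<^sup>2 \<le> (C * norm y)\<^sup>2"
    by (simp add: power_mult_distrib)
qed (use assms(2) in auto)

section \<open>Diagonal operators and their functional calculus\<close>

text \<open>A bounded multiplier preserves square summability, so Riesz-Fischer supplies the image
  vector. Resolvents and functions of a diagonal operator are built this way.\<close>

lemma diagonal_operator_exists:
  fixes a :: "nat \<Rightarrow> real"
  assumes "\<And>n. \<bar>a n\<bar> \<le> C"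
  obtains S where "bounded_linear S" "\<And>x n. S x \<bullet> e n = a n * (x \<bullet> e n)"
proof -
  have "C \<ge> 0" using assms[of 0] by simp
  have "summable (\<lambda>n. (a n * (x \<bullet> e n))\<^sup>2)" for x
  proof (rule summable_comparison_test')
    show "summable (\<lambda>n. C\<^sup>2 * (x \<bullet> e n)\<^sup>2)"
      by (intro summable_mult summable_coeffs)
    show "norm ((a n * (x \<bullet> e n))\<^sup>2) \<le> C\<^sup>2 * (x \<bullet> e n)\<^sup>2" for n
      using power_mono[OF assms, of n 2] by (simp add: power_mult_distrib mult_right_mono)
  qed
  then have "\<exists>z. \<forall>n. z \<bullet> e n = a n * (x \<bullet> e n)" for x
    by (rule Riesz_Fischer) blast
  then obtain S where S: "\<And>x n. S x \<bullet> e n = a n * (x \<bullet> e n)"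
    by metis
  have "bounded_linear S"
  proof (rule bounded_linear_intro)
    show "S (x + y) = S x + S y" for x y
      by (rule eq_if_coeffs_eq) (simp add: S inner_add_left algebra_simps)
    show "S (r *\<^sub>R x) = r *\<^sub>R S x" for r x
      by (rule eq_if_coeffs_eq) (simp add: S)
    show "norm (S x) \<le> norm x * C" for x
      using norm_le_if_coeffs_le[of "S x" C x] assms \<open>C \<ge> 0\<close>
      by (simp add: S abs_mult mult_right_mono mult.commute)
  qed
  then show thesis using S by (rule that)
qed

text \<open>Continuity allows \<open>T\<close> to be applied to the expansion of \<open>x\<close>
  term by term.\<close>

lemma coeff_diagonal:
  assumes "bounded_linear T" "\<And>n. T (e n) = a n *\<^sub>R e n"
  shows "T x \<bullet> e n = a n * (x \<bullet> e n)"
proof -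
  interpret bounded_linear T by fact
  have "(\<lambda>i. T ((x \<bullet> e i) *\<^sub>R e i) \<bullet> e n) sums (T x \<bullet> e n)"
    by (intro bounded_linear.sums[OF bounded_linear_inner_left] sums expansion)
  also have "(\<lambda>i. T ((x \<bullet> e i) *\<^sub>R e i) \<bullet> e n) = (\<lambda>i. if i = n then a i * (x \<bullet> e i) else 0)"
    by (auto simp: scaleR assms orthonormal)
  finally show ?thesis
    using sums_single[of n "\<lambda>i. a i * (x \<bullet> e i)"] sums_unique2 by blast
qed

lemma adjoint_diagonal:
  assumes "bounded_linear T" "\<And>n. T (e n) = a n *\<^sub>R e n"
  shows "adjoint T = T"
proof (rule adjoint_unique, intro allI)
  fix x y
  have "(\<lambda>n. (T x \<bullet> e n) * (y \<bullet> e n)) = (\<lambda>n. (x \<bullet> e n) * (T y \<bullet> e n))"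
    by (simp add: coeff_diagonal[OF assms] algebra_simps)
  then show "T x \<bullet> y = x \<bullet> T y"
    using inner_expansion[of "T x" y] inner_expansion[of x "T y"] sums_unique2 by metis
qed

text \<open>For \<open>t\<close> outside the interval, the diagonal operator with entries
  \<open>1 / (a n - t)\<close> is bounded and inverts \<open>T - t\<close>.\<close>

lemma spectrum_diagonal_subset:
  assumes T: "bounded_linear T" "\<And>n. T (e n) = a n *\<^sub>R e n"
    and a: "\<And>n. a n \<in> {l..u}"
  shows "spectrum T \<subseteq> {l..u}"
proof
  fix t assume "t \<in> spectrum T"
  show "t \<in> {l..u}"
  proof (rule ccontr)
    assume t: "t \<notin> {l..u}"
    \<comment> \<open>The distance from \<open>t\<close> to the interval; it bounds the entries of
      the resolvent by \<open>1 / d\<close>.\<close>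
    define d where "d = max (l - t) (t - u)"
    have d: "d > 0" "d \<le> \<bar>a n - t\<bar>" for n
      using t a[of n] by (auto simp: d_def max_def)
    have "\<bar>1 / (a n - t)\<bar> \<le> 1 / d" for n
      using d(1) d(2)[of n] by (simp add: frac_le)
    then obtain R where R: "bounded_linear R" "\<And>x n. R x \<bullet> e n = 1 / (a n - t) * (x \<bullet> e n)"
      using diagonal_operator_exists[of "\<lambda>n. 1 / (a n - t)"] by blast
    have [simp]: "a n \<noteq> t" for n
      using d(1) d(2)[of n] by auto
    \<comment> \<open>The two inverse laws, read on a single coefficient \<open>r\<close>.\<close>
    have *: "1 / (a n - t) * (a n * r - t * r) = r"
      "a n * (1 / (a n - t) * r) - t * (1 / (a n - t) * r) = r" for n r
      by (simp_all add: divide_simps) (simp_all add: algebra_simps)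
    have "R (T x - t *\<^sub>R x) = x" for x
      by (rule eq_if_coeffs_eq)
        (simp only: R(2) inner_diff_left coeff_diagonal[OF T] inner_scaleR_left *)
    moreover have "T (R x) - t *\<^sub>R R x = x" for x
      by (rule eq_if_coeffs_eq)
        (simp only: R(2) inner_diff_left coeff_diagonal[OF T] inner_scaleR_left *)
    ultimately show False
      using \<open>t \<in> spectrum T\<close> R(1) by (auto simp: spectrum_def)
  qed
qed

text \<open>The diagonal operator \<open>S\<close> with entries \<open>f (a n)\<close> satisfies the
  defining condition: each \<open>a n\<close> is an eigenvalue, so uniform convergence on the
  spectrum bounds all entries of \<open>p(T) - S\<close> at once. Pointwise limits show that no
  other operator does.\<close>

lemma coeff_functional_calculus:
  fixes f :: "real \<Rightarrow> real"
  assumes T: "bounded_linear T" "\<And>n. T (e n) = a n *\<^sub>R e n"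
    and a: "\<And>n. a n \<in> {l..u}" and f: "continuous_on {l..u} f"
  shows "functional_calculus f T x \<bullet> e n = f (a n) * (x \<bullet> e n)"
proof -
  have "bounded (f ` {l..u})"
    using f by (intro compact_imp_bounded compact_continuous_image) auto
  then obtain C where "\<And>n. \<bar>f (a n)\<bar> \<le> C"
    using a unfolding bounded_iff real_norm_def by blast
  then obtain S where S: "bounded_linear S" "\<And>x n. S x \<bullet> e n = f (a n) * (x \<bullet> e n)"
    using diagonal_operator_exists[of "\<lambda>n. f (a n)"] by blast
  have p_T: "bounded_linear (poly_operator p T)" for p
    by (rule bounded_linear_poly_operator[OF T(1)])
  have coeff_p_T: "poly_operator p T x \<bullet> e n = poly p (a n) * (x \<bullet> e n)" for p x n
    using T by (intro coeff_diagonal p_T poly_operator_eigenvector bounded_linear.linear)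
  let ?converges = "\<lambda>S p. (\<lambda>n. onorm (\<lambda>x. poly_operator (p n) T x - S x)) \<longlonglongrightarrow> 0"
  have S_limit: "?converges S p"
    if p: "uniform_limit (spectrum T) (\<lambda>n. poly (p n)) f sequentially" for p
  proof (rule tendstoI)
    fix \<epsilon> :: real assume "\<epsilon> > 0"
    then have "\<forall>\<^sub>F n in sequentially. \<forall>t\<in>spectrum T. dist (poly (p n) t) (f t) < \<epsilon> / 2"
      using uniform_limitD[OF p, of "\<epsilon> / 2"] by simp
    then show "\<forall>\<^sub>F n in sequentially. dist (onorm (\<lambda>x. poly_operator (p n) T x - S x)) 0 < \<epsilon>"
    proof eventually_elim
      case (elim n)
      have "\<bar>poly (p n) (a k) - f (a k)\<bar> \<le> \<epsilon> / 2" for k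
        using elim eigenvalue_in_spectrum[of T, OF T(2) e_nonzero, of k]
        by (auto simp: dist_real_def intro: less_imp_le)
      then have "\<bar>(poly_operator (p n) T x - S x) \<bullet> e k\<bar> \<le> \<epsilon> / 2 * \<bar>x \<bullet> e k\<bar>" for x k
        unfolding inner_diff_left S coeff_p_T left_diff_distrib[symmetric] abs_mult
        by (intro mult_right_mono) auto
      then have "norm (poly_operator (p n) T x - S x) \<le> \<epsilon> / 2 * norm x" for x
        using \<open>\<epsilon> > 0\<close> by (intro norm_le_if_coeffs_le) auto
      then have "onorm (\<lambda>x. poly_operator (p n) T x - S x) \<le> \<epsilon> / 2"
        using \<open>\<epsilon> > 0\<close> by (intro onorm_bound) auto
      moreover have "onorm (\<lambda>x. poly_operator (p n) T x - S x) \<ge> 0"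
        by (intro onorm_pos_le bounded_linear_sub p_T S(1))
      ultimately show ?case using \<open>\<epsilon> > 0\<close> by simp
    qed
  qed
  \<comment> \<open>Uniqueness needs one approximating sequence; without any, the condition on
    \<open>S'\<close> would be vacuous.\<close>
  obtain p where "uniform_limit {l..u} (\<lambda>n. poly (p n)) f sequentially"
    using Weierstrass_uniform_limit[OF _ f] by auto
  then have p: "uniform_limit (spectrum T) (\<lambda>n. poly (p n)) f sequentially"
    using uniform_limit_on_subset spectrum_diagonal_subset[OF T a] by blast
  have "functional_calculus f T = S"
    unfolding functional_calculus_def
  proof (rule the_equality)
    show "bounded_linear S \<and> (\<forall>p. uniform_limit (spectrum T) (\<lambda>n. poly (p n)) f sequentially
        \<longrightarrow> ?converges S p)"
      using S(1) S_limit by blast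
  next
    fix S' assume S': "bounded_linear S' \<and>
      (\<forall>p. uniform_limit (spectrum T) (\<lambda>n. poly (p n)) f sequentially \<longrightarrow> ?converges S' p)"
    show "S' = S"
    proof
      fix x
      have "(\<lambda>n. poly_operator (p n) T x) \<longlonglongrightarrow> S' x"
        using S' p by (intro tendsto_if_onorm_tendsto_0[of "\<lambda>n. poly_operator (p n) T"] p_T) auto
      moreover have "(\<lambda>n. poly_operator (p n) T x) \<longlonglongrightarrow> S x"
        using S S_limit p by (intro tendsto_if_onorm_tendsto_0[of "\<lambda>n. poly_operator (p n) T"] p_T) auto
      ultimately show "S' x = S x" by (rule LIMSEQ_unique)
    qed
  qed
  then show ?thesis using S by simp
qed

text \<open>\<open>T\<close> is its own adjoint, so \<open>adjoint T \<circ> T\<close> has the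
  entries \<open>(a n)\<^sup>2\<close>, and its power \<open>\<nu> / 2\<close> has the entries
  \<open>a n powr \<nu>\<close> because \<open>a n\<close> is non-negative.\<close>

lemma standard_source_condition_diagonal_iff:
  assumes T: "bounded_linear T" "\<And>n. T (e n) = a n *\<^sub>R e n"
    and a: "\<And>n. a n \<in> {0..C}" and "\<nu> > 0"
  shows "standard_source_condition T u \<nu> \<longleftrightarrow> (\<exists>w. \<forall>n. u \<bullet> e n = a n powr \<nu> * (w \<bullet> e n))"
proof -
  interpret bounded_linear T by fact
  have "bounded_linear (adjoint T \<circ> T)"
    using bounded_linear_compose[OF T(1) T(1)] by (simp add: adjoint_diagonal[OF T] o_def)
  moreover have "(adjoint T \<circ> T) (e n) = (a n)\<^sup>2 *\<^sub>R e n" for n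
    by (simp add: adjoint_diagonal[OF T] T(2) scaleR power2_eq_square)
  moreover have "(a n)\<^sup>2 \<in> {0..C\<^sup>2}" for n
    using a[of n] by (auto intro: power_mono)
  \<comment> \<open>Positivity of the exponent gives continuity at the endpoint 0, where
    \<open>powr\<close> has the value 0.\<close>
  moreover have "continuous_on {0..C\<^sup>2} (\<lambda>t. t powr (\<nu> / 2))"
    using \<open>\<nu> > 0\<close> by (intro continuous_on_powr' continuous_intros) auto
  ultimately have "operator_power (adjoint T \<circ> T) (\<nu> / 2) w \<bullet> e n = (a n)\<^sup>2 powr (\<nu> / 2) * (w \<bullet> e n)" for w n
    unfolding operator_power_def by (rule coeff_functional_calculus)
  moreover have "(a n)\<^sup>2 powr (\<nu> / 2) = a n powr \<nu>" for n
  proof (cases "a n = 0")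
    case False
    then show ?thesis
      using a[of n] by (simp add: powr_powr flip: powr_numeral)
  qed simp
  ultimately have "u = operator_power (adjoint T \<circ> T) (\<nu> / 2) w \<longleftrightarrow>
      (\<forall>n. u \<bullet> e n = a n powr \<nu> * (w \<bullet> e n))" for w
    by (simp add: eq_iff_coeffs_eq)
  then show ?thesis
    unfolding standard_source_condition_def by auto
qed

section \<open>The two conditions for the geometric coefficients\<close>

lemma homogeneous_variational_inequality_if_geometric:
  assumes L: "bounded_linear L" "\<And>n. L (e n) = 2 powr (- real (Suc n)) *\<^sub>R e n"
    and u: "\<And>n. u \<bullet> e n = 2 powr (- real (Suc n) / 2)"
  shows "homogeneous_variational_inequality L u (1/2)"
  unfolding homogeneous_variational_inequality_def
proof (intro exI conjI allI)
  interpret bounded_linear L by fact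
  \<comment> \<open>The common ratio: \<open>u\<close> has the coefficients
    \<open>1 / q ^ Suc n\<close>, and \<open>L\<close> divides by
    \<open>q ^ (2 * Suc n)\<close>.\<close>
  define q where "q = sqrt 2"
  have q: "q > 1" "q * q = 2" by (auto simp: q_def)
  have u_q: "u \<bullet> e n = 1 / q ^ Suc n" for n
  proof -
    have "2 powr (- real (Suc n) / 2) = (2 powr (1/2)) powr (- real (Suc n))"
      by (simp add: powr_powr)
    also have "\<dots> = 1 / q ^ Suc n"
      unfolding powr_minus_divide by (subst powr_realpow) (auto simp: q_def powr_half_sqrt)
    finally show ?thesis by (simp add: u)
  qed
  have L_q: "L v \<bullet> e n = (v \<bullet> e n) / 2 ^ Suc n" for v n
    using coeff_diagonal[OF L, of v n] unfolding powr_minus_divide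
    by (subst (asm) powr_realpow) auto
  have le_norm: "\<bar>v \<bullet> e n\<bar> \<le> norm v" for v n
    using Cauchy_Schwarz_ineq2[of v "e n"] orthonormal[of n n] by (simp add: norm_eq_sqrt_inner)
  \<comment> \<open>Twice the constant of \<open>sum_le_if_geometric_bounds\<close>; the 2 comes
    from the left-hand side \<open>2 * (u \<bullet> v)\<close>.\<close>
  let ?\<beta> = "4 * q / (q - 1)"
  show "?\<beta> \<ge> 0" using q by simp
  fix v
  show "2 * (u \<bullet> v) \<le> ?\<beta> * norm (L v) powr (1/2) * norm v powr (1 - 1/2)"
  \<comment> \<open>The sum estimate needs positive \<open>a\<close> and \<open>b\<close>. For
    \<open>v \<noteq> 0\<close> injectivity of \<open>L\<close> makes both norms positive; for
    \<open>v = 0\<close> both sides vanish.\<close>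
  proof (cases "v = 0")
    case False
    have "L v \<noteq> 0"
    proof
      assume "L v = 0"
      then have "v = 0"
        using L_q[of v] by (intro eq_if_coeffs_eq) simp
      with False show False by simp
    qed
    have "(\<Sum>n<M. (u \<bullet> e n) * (v \<bullet> e n))
        \<le> 2 * q / (q - 1) * (sqrt (norm (L v)) * sqrt (norm v))" for M
    proof -
      define t where "t n = \<bar>v \<bullet> e n\<bar> / q ^ Suc n" for n
      have "t n \<le> q ^ n * (q * norm (L v))" for n
      proof -
        have "(q * q) ^ Suc n = q ^ Suc n * q ^ Suc n"
          by (rule power_mult_distrib)
        then have "t n = q ^ Suc n * \<bar>L v \<bullet> e n\<bar>"
          using q unfolding t_def L_q by (simp add: field_simps abs_mult)
        also have "\<dots> \<le> q ^ Suc n * norm (L v)"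
          using q by (intro mult_left_mono le_norm) auto
        finally show ?thesis by (simp add: mult_ac)
      qed
      moreover have "t n \<le> (norm v / q) / q ^ n" for n
      proof -
        have "t n \<le> norm v / q ^ Suc n"
          unfolding t_def using q by (intro divide_right_mono le_norm) auto
        then show ?thesis by (simp add: field_simps)
      qed
      moreover have "0 \<le> t n" for n
        using q by (simp add: t_def)
      ultimately have "sum t {..<M} \<le> 2 * q / (q - 1) * (sqrt (q * norm (L v)) * sqrt (norm v / q))"
        using False \<open>L v \<noteq> 0\<close> q by (intro sum_le_if_geometric_bounds) auto
      \<comment> \<open>The factors \<open>q\<close> and \<open>1 / q\<close> stem from the index
        shift \<open>Suc n\<close> and cancel in the geometric mean.\<close>
      also have "sqrt (q * norm (L v)) * sqrt (norm v / q) = sqrt (norm (L v)) * sqrt (norm v)"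
        using q by (simp add: field_simps flip: real_sqrt_mult)
      finally have "sum t {..<M} \<le> 2 * q / (q - 1) * (sqrt (norm (L v)) * sqrt (norm v))" .
      moreover have "(\<Sum>n<M. (u \<bullet> e n) * (v \<bullet> e n)) \<le> sum t {..<M}"
        using q by (intro sum_mono) (auto simp: u_q t_def divide_right_mono)
      ultimately show ?thesis by linarith
    qed
    \<comment> \<open>The bound does not depend on \<open>M\<close>, so it passes to the limit of
      the partial sums.\<close>
    then have "u \<bullet> v \<le> 2 * q / (q - 1) * (sqrt (norm (L v)) * sqrt (norm v))"
      by (intro LIMSEQ_le_const2[OF inner_expansion[of u v, unfolded sums_def]]) blast
    then show ?thesis
      by (simp add: powr_half_sqrt mult.assoc)
  qed (simp add: zero)
qed

text \<open>Division by the entries of the operator power forces the coefficients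
  \<open>2 powr ((\<nu> - 1/2) * Suc n)\<close> on a source element, so the question is whether
  these are square summable.\<close>

lemma standard_source_condition_iff_if_geometric:
  assumes L: "bounded_linear L" "\<And>n. L (e n) = 2 powr (- real (Suc n)) *\<^sub>R e n"
    and u: "\<And>n. u \<bullet> e n = 2 powr (- real (Suc n) / 2)" and "\<nu> > 0"
  shows "standard_source_condition L u \<nu> \<longleftrightarrow> \<nu> < 1/2"
proof -
  have "2 powr (- real (Suc n)) \<in> {0..(1::real)}" for n
    using powr_mono[of "- real (Suc n)" 0 "2::real"] by simp
  note iff = standard_source_condition_diagonal_iff[OF L this \<open>\<nu> > 0\<close>, of u]
  let ?c = "\<lambda>n. 2 powr ((\<nu> - 1/2) * real (Suc n)) :: real"
  have coeffs: "u \<bullet> e n = (2 powr (- real (Suc n))) powr \<nu> * r \<longleftrightarrow> r = ?c n" for n r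
  proof -
    have "2 powr (- real (Suc n) / 2) = (2 powr (- real (Suc n))) powr \<nu> * ?c n"
      unfolding powr_powr by (simp flip: powr_add) (simp add: field_simps)
    then show ?thesis by (auto simp: u)
  qed
  have *: "standard_source_condition L u \<nu> \<longleftrightarrow> (\<exists>w. \<forall>n. w \<bullet> e n = ?c n)"
    by (simp only: iff coeffs)
  show ?thesis
  proof
    assume "standard_source_condition L u \<nu>"
    then obtain w where "\<And>n. w \<bullet> e n = ?c n"
      using * by blast
    then have "(\<lambda>n. (?c n)\<^sup>2) \<longlonglongrightarrow> 0"
      using summable_LIMSEQ_zero[OF summable_coeffs[of w]] by simp
    \<comment> \<open>For \<open>\<nu> \<ge> 1/2\<close> the squares never fall below 1, whereas
      those of a vector's coefficients tend to 0.\<close>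
    moreover have "(?c n)\<^sup>2 \<ge> 1" if "\<nu> \<ge> 1/2" for n
      using that by (intro one_le_power ge_one_powr_ge_zero) auto
    ultimately show "\<nu> < 1/2"
      using LIMSEQ_le_const[of "\<lambda>n. (?c n)\<^sup>2" 0 1] by force
  next
    assume "\<nu> < 1/2"
    let ?r = "2 powr (2 * (\<nu> - 1/2)) :: real"
    have "(?c n)\<^sup>2 = ?r * ?r ^ n" for n
    proof -
      have "(?c n)\<^sup>2 = 2 powr (2 * ((\<nu> - 1/2) * real (Suc n)))"
        by (simp add: power2_eq_square mult.commute flip: powr_add)
      also have "\<dots> = ?r powr real (Suc n)"
        unfolding powr_powr by (simp only: mult.assoc)
      also have "\<dots> = ?r ^ Suc n"
        by (rule powr_realpow) simp
      finally show ?thesis by simp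
    qed
    moreover have "norm ?r < 1"
      using \<open>\<nu> < 1/2\<close> powr_less_mono[of "2 * (\<nu> - 1/2)" 0 2] by simp
    ultimately have "summable (\<lambda>n. (?c n)\<^sup>2)"
      by (simp add: summable_mult summable_geometric)
    then show "standard_source_condition L u \<nu>"
      by (rule Riesz_Fischer) (use * in blast)
  qed
qed

end

section \<open>Transfer to the given basis and conclusion\<close>

lemma hilbert_basis_Suc:
  assumes "orthonormal_basis_on {1..} \<phi>"
  shows "hilbert_basis (\<lambda>n. \<phi> (Suc n))"
proof
  have "range (\<lambda>n. \<phi> (Suc n)) = \<phi> ` {1..}"
    by (auto simp: image_iff) (metis Suc_le_D)
  then show "closure (span (range (\<lambda>n. \<phi> (Suc n)))) = UNIV"
    using assms by (simp add: orthonormal_basis_on_def)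
  show "\<phi> (Suc i) \<bullet> \<phi> (Suc j) = (if i = j then 1 else 0)" for i j
    using assms by (simp add: orthonormal_basis_on_def)
qed

theorem mainTheorem2:
  fixes \<phi> :: "nat \<Rightarrow> 'a::{real_inner, banach, second_countable_topology}"
    and L :: "'a \<Rightarrow> 'a" and y u :: 'a
  assumes "orthonormal_basis_on {1..} \<phi>"
    and "compact_operator L"
    and "\<And>n. n \<ge> 1 \<Longrightarrow> L (\<phi> n) = 2 powr (- real n) *\<^sub>R \<phi> n"
    and "((\<lambda>n. 2 powr (- (3/2) * real n) *\<^sub>R \<phi> n) has_sum y) {1..}"
    and "u = min_norm_solution L y"
  shows "y \<in> range L
    \<and> homogeneous_variational_inequality L u (1/2)
    \<and> \<not> standard_source_condition L u (1/2)
    \<and> (\<forall>\<nu>\<in>{0<..<1/2}. standard_source_condition L u \<nu>)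
    \<and> \<not> (\<forall>(K :: 'a \<Rightarrow> 'a) z. compact_operator K \<longrightarrow> z \<in> range K \<longrightarrow>
           (standard_source_condition K (min_norm_solution K z) (1/2) \<longleftrightarrow>
            homogeneous_variational_inequality K (min_norm_solution K z) (1/2)))"
proof -
  define e where "e n = \<phi> (Suc n)" for n
  interpret hilbert_basis e
    unfolding e_def by (rule hilbert_basis_Suc[OF assms(1)])
  have L: "bounded_linear L" "\<And>n. L (e n) = 2 powr (- real (Suc n)) *\<^sub>R e n"
    using assms(3)[of "Suc _"] compact_operator_imp_bounded_linear[OF assms(2)]
    by (simp_all add: e_def)
  have y: "y \<bullet> e n = 2 powr (- (3/2) * real (Suc n))" for n
  proof -
    let ?f = "\<lambda>i. (2 powr (- (3/2) * real i) *\<^sub>R \<phi> i) \<bullet> e n"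
    have "(?f has_sum (y \<bullet> e n)) {1..}"
      by (rule has_sum_bounded_linear[OF bounded_linear_inner_left assms(4)])
    moreover have "(?f has_sum ?f (Suc n)) {1..}"
      using assms(1) by (intro has_sum_finite_neutralI[of "{Suc n}"])
        (auto simp: e_def orthonormal_basis_on_def)
    ultimately have "y \<bullet> e n = ?f (Suc n)"
      by (rule has_sum_unique)
    then show ?thesis
      using orthonormal[of n n] by (simp add: e_def)
  qed
  \<comment> \<open>The candidate solution, found by dividing the coefficients of \<open>y\<close>
    by the eigenvalues: \<open>-3/2 + 1 = -1/2\<close> in the exponent.\<close>
  obtain x where x: "\<And>n. x \<bullet> e n = 2 powr (- real (Suc n) / 2)"
  proof (rule Riesz_Fischer)
    have "(2 powr (- real (Suc n) / 2))\<^sup>2 = (1/2) * (1/2 :: real) ^ n" for n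
    proof -
      have "(2 powr (- real (Suc n) / 2))\<^sup>2 = (2 :: real) powr (- real (Suc n))"
        unfolding power2_eq_square powr_add[symmetric] by (rule arg_cong[of _ _ "(powr) 2"]) simp
      also have "\<dots> = 1 / 2 ^ Suc n"
        unfolding powr_minus_divide by (subst powr_realpow) auto
      finally show ?thesis by (simp add: power_one_over)
    qed
    then show "summable (\<lambda>n. (2 powr (- real (Suc n) / 2) :: real)\<^sup>2)"
      by (simp only: summable_mult summable_geometric) simp
  qed (rule that)
  \<comment> \<open>All eigenvalues are nonzero, so \<open>x\<close> is the only solution and
    therefore the one of minimal norm.\<close>
  have L_iff: "L v = y \<longleftrightarrow> v = x" for v
  proof -
    have y_x: "y \<bullet> e n = 2 powr (- real (Suc n)) * (x \<bullet> e n)" for n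
      unfolding x y powr_add[symmetric]
      by (rule arg_cong[of _ _ "(powr) 2"]) (simp add: field_simps)
    show ?thesis
      by (simp add: eq_iff_coeffs_eq coeff_diagonal[OF L] y_x)
  qed
  then have "u = x"
    using assms(5) min_norm_solution_unique by metis
  then have u: "\<And>n. u \<bullet> e n = 2 powr (- real (Suc n) / 2)"
    using x by simp
  have range: "y \<in> range L"
    using L_iff by (metis rangeI)
  note source = standard_source_condition_iff_if_geometric[OF L u]
  have hvi: "homogeneous_variational_inequality L u (1/2)"
    by (rule homogeneous_variational_inequality_if_geometric[OF L u])
  have not_source: "\<not> standard_source_condition L u (1/2)"
    using source[of "1/2"] by simp
  show ?thesis
  proof (intro conjI)
    show "\<forall>\<nu>\<in>{0<..<1/2}. standard_source_condition L u \<nu>"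
      using source by auto
    \<comment> \<open>The counterexample to equivalence is \<open>K = L\<close>,
      \<open>z = y\<close>.\<close>
    show "\<not> (\<forall>(K :: 'a \<Rightarrow> 'a) z. compact_operator K \<longrightarrow> z \<in> range K \<longrightarrow>
        (standard_source_condition K (min_norm_solution K z) (1/2) \<longleftrightarrow>
         homogeneous_variational_inequality K (min_norm_solution K z) (1/2)))"
      using range hvi not_source assms(2) unfolding assms(5) by blast
  qed (fact range hvi not_source)+
qed

end
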